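(* Let $(\Omega,\mathcal{F},\mathbb{P})$ be a probability space and let $\mathcal{G}\subset\mathcal{F}$ be a $\sigma$-algebra. Given any $X\in L^2(\Omega,\mathcal{F},\mathbb{P})$, there is a unique critical point of the functional $J:L^2(\Omega,\mathcal{G},\mathbb{P})\to\mathbb{R}$ defined by $$J(Y):=\frac{1}{2}\int_{\Omega}|Y|^2\,d\mathbb{P}-\int_{\Omega}X\cdot Y\,d\mathbb{P}.$$
   Context: All random variables are real-valued, and two random variables are identified if they are equal almost surely. $L^2(\Omega,\mathcal{G},\mathbb{P})$ denotes the square-integrable $\mathcal{G}$-measurable random variables, with $\mathbb{P}$ restricted to $\mathcal{G}$; it is a closed linear subspace of $L^2(\Omega,\mathcal{F},\mathbb{P})$ and a real Hilbert space with inner product $\langle X,Y\rangle_2=\int_\Omega X\cdot Y\,d\mathbb{P}$. Critical point: for a real Hilbert space $H$, a function $F:H\to\mathbb{R}$ is Gateaux-differentiable at $u\in H$ if for every $v\in H$ the limit $F'_u(v):=\lim_{t\to0}\frac{F(u+tv)-F(u)}{t}$ exists and $F'_u:H\to\mathbb{R}$ is linear and continuous. A point $u_0\in H$ is a critical point of $F$ if $F'_{u_0}(v)=0$ for all $v\in H$. *)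

theory Defs
  imports "HOL-Probability.Probability"
begin

record 'v hilbert_ops =
  vectors :: "'v set"
  vzero   :: "'v"
  vadd    :: "'v \<Rightarrow> 'v \<Rightarrow> 'v"
  vscale  :: "real \<Rightarrow> 'v \<Rightarrow> 'v"
  vinner  :: "'v \<Rightarrow> 'v \<Rightarrow> real"

definition vdist :: "'v hilbert_ops \<Rightarrow> 'v \<Rightarrow> 'v \<Rightarrow> real" where
  "vdist H v w = (let d = vadd H v (vscale H (-1) w) in sqrt (vinner H d d))"

text \<open>
  Real Hilbert spaces with an explicit carrier: a space of random variables depends on its
  measure, so it cannot be an instance of the type class of complete inner product spaces.
  Additive inverses come from \<open>add_neg\<close>.
\<close>

locale real_hilbert_space =
  fixes H :: "'v hilbert_ops"
  assumes zero_closed: "vzero H \<in> vectors H"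
    and add_closed: "\<lbrakk>u \<in> vectors H; v \<in> vectors H\<rbrakk> \<Longrightarrow> vadd H u v \<in> vectors H"
    and scale_closed: "u \<in> vectors H \<Longrightarrow> vscale H c u \<in> vectors H"
    and add_assoc: "\<lbrakk>u \<in> vectors H; v \<in> vectors H; w \<in> vectors H\<rbrakk>
      \<Longrightarrow> vadd H (vadd H u v) w = vadd H u (vadd H v w)"
    and add_commute: "\<lbrakk>u \<in> vectors H; v \<in> vectors H\<rbrakk> \<Longrightarrow> vadd H u v = vadd H v u"
    and add_zero: "u \<in> vectors H \<Longrightarrow> vadd H u (vzero H) = u"
    and add_neg: "u \<in> vectors H \<Longrightarrow> vadd H u (vscale H (-1) u) = vzero H"
    and scale_one: "u \<in> vectors H \<Longrightarrow> vscale H 1 u = u"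
    and scale_scale: "u \<in> vectors H \<Longrightarrow> vscale H b (vscale H c u) = vscale H (b * c) u"
    and scale_add_right: "\<lbrakk>u \<in> vectors H; v \<in> vectors H\<rbrakk>
      \<Longrightarrow> vscale H c (vadd H u v) = vadd H (vscale H c u) (vscale H c v)"
    and scale_add_left: "u \<in> vectors H
      \<Longrightarrow> vscale H (b + c) u = vadd H (vscale H b u) (vscale H c u)"
    and inner_commute: "\<lbrakk>u \<in> vectors H; v \<in> vectors H\<rbrakk> \<Longrightarrow> vinner H u v = vinner H v u"
    and inner_add: "\<lbrakk>u \<in> vectors H; v \<in> vectors H; w \<in> vectors H\<rbrakk>
      \<Longrightarrow> vinner H (vadd H u v) w = vinner H u w + vinner H v w"
    and inner_scale: "\<lbrakk>u \<in> vectors H; v \<in> vectors H\<rbrakk>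
      \<Longrightarrow> vinner H (vscale H c u) v = c * vinner H u v"
    and inner_nonneg: "u \<in> vectors H \<Longrightarrow> vinner H u u \<ge> 0"
    and inner_eq_zero: "u \<in> vectors H \<Longrightarrow> vinner H u u = 0 \<Longrightarrow> u = vzero H"
    and complete: "\<lbrakk>\<And>n. U n \<in> vectors H;
        \<And>e. e > 0 \<Longrightarrow> \<exists>N. \<forall>m\<ge>N. \<forall>n\<ge>N. vdist H (U m) (U n) < e\<rbrakk>
      \<Longrightarrow> \<exists>u\<in>vectors H. (\<lambda>n. vdist H (U n) u) \<longlonglongrightarrow> 0"
begin

definition linear_functional :: "('v \<Rightarrow> real) \<Rightarrow> bool" where
  "linear_functional L \<longleftrightarrow>
     (\<forall>v\<in>vectors H. \<forall>w\<in>vectors H. L (vadd H v w) = L v + L w) \<and>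
     (\<forall>c. \<forall>v\<in>vectors H. L (vscale H c v) = c * L v)"

definition continuous_functional :: "('v \<Rightarrow> real) \<Rightarrow> bool" where
  "continuous_functional L \<longleftrightarrow>
     (\<forall>v\<in>vectors H. \<forall>e>0. \<exists>d>0. \<forall>w\<in>vectors H. vdist H w v < d \<longrightarrow> \<bar>L w - L v\<bar> < e)"

definition diff_quotient :: "('v \<Rightarrow> real) \<Rightarrow> 'v \<Rightarrow> 'v \<Rightarrow> real \<Rightarrow> real" where
  "diff_quotient F u v t = (F (vadd H u (vscale H t v)) - F u) / t"

text \<open>Only meaningful when the limit exists.\<close>

definition gateaux_deriv :: "('v \<Rightarrow> real) \<Rightarrow> 'v \<Rightarrow> 'v \<Rightarrow> real" where
  "gateaux_deriv F u v = Lim (at 0) (diff_quotient F u v)"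

definition gateaux_differentiable :: "('v \<Rightarrow> real) \<Rightarrow> 'v \<Rightarrow> bool" where
  "gateaux_differentiable F u \<longleftrightarrow>
     u \<in> vectors H \<and>
     (\<forall>v\<in>vectors H. \<exists>l. (diff_quotient F u v \<longlongrightarrow> l) (at 0)) \<and>
     linear_functional (gateaux_deriv F u) \<and>
     continuous_functional (gateaux_deriv F u)"

definition critical_point :: "('v \<Rightarrow> real) \<Rightarrow> 'v \<Rightarrow> bool" where
  "critical_point F u \<longleftrightarrow>
     gateaux_differentiable F u \<and> (\<forall>v\<in>vectors H. gateaux_deriv F u v = 0)"

end

text \<open>
  Random variables on \<open>P\<close> up to almost sure equality: a class consists of functions
  measurable for the full sigma-algebra of \<open>P\<close>, also when it has a representative measurable
  for a smaller one.  Thus the space for a sub-sigma-algebra is literally a subset of the one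
  for \<open>P\<close>.
\<close>

definition rv_class :: "'a measure \<Rightarrow> ('a \<Rightarrow> real) \<Rightarrow> ('a \<Rightarrow> real) set" where
  "rv_class P f = {g \<in> borel_measurable P. AE x in P. g x = f x}"

definition rv_rep :: "('a \<Rightarrow> real) set \<Rightarrow> 'a \<Rightarrow> real" where
  "rv_rep U = (SOME f. f \<in> U)"

definition square_integrable :: "'a measure \<Rightarrow> ('a \<Rightarrow> real) set" where
  "square_integrable N = {f \<in> borel_measurable N. integrable N (\<lambda>x. (f x)\<^sup>2)}"

text \<open>
  The measure \<open>G\<close> only serves to carry a sub-sigma-algebra of \<open>P\<close>; the full space is
  \<open>L2 P P\<close>.  The operations do not depend on the representatives.
\<close>

definition L2 :: "'a measure \<Rightarrow> 'a measure \<Rightarrow> ('a \<Rightarrow> real) set hilbert_ops" where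
  "L2 P G =
     \<lparr> vectors = rv_class P ` square_integrable (restr_to_subalg P G),
       vzero = rv_class P (\<lambda>x. 0),
       vadd = (\<lambda>U V. rv_class P (\<lambda>x. rv_rep U x + rv_rep V x)),
       vscale = (\<lambda>c U. rv_class P (\<lambda>x. c * rv_rep U x)),
       vinner = (\<lambda>U V. \<integral>x. rv_rep U x * rv_rep V x \<partial>P) \<rparr>"

definition J :: "'a measure \<Rightarrow> ('a \<Rightarrow> real) set \<Rightarrow> ('a \<Rightarrow> real) set \<Rightarrow> real" where
  "J P X Y = 1 / 2 * (\<integral>x. \<bar>rv_rep Y x\<bar>\<^sup>2 \<partial>P) - (\<integral>x. rv_rep X x * rv_rep Y x \<partial>P)"

lemma rv_rep_class:
  assumes "f \<in> borel_measurable P"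
  shows "rv_rep (rv_class P f) \<in> borel_measurable P"
    and "AE x in P. rv_rep (rv_class P f) x = f x"
proof -
  have "f \<in> rv_class P f" using assms by (simp add: rv_class_def)
  then have "rv_rep (rv_class P f) \<in> rv_class P f" unfolding rv_rep_def by (rule someI[where P = "\<lambda>g. g \<in> rv_class P f"])
  then show "rv_rep (rv_class P f) \<in> borel_measurable P"
    and "AE x in P. rv_rep (rv_class P f) x = f x" by (auto simp: rv_class_def)
qed

lemma rv_class_eq_iff:
  assumes "f \<in> borel_measurable P" "g \<in> borel_measurable P"
  shows "rv_class P f = rv_class P g \<longleftrightarrow> (AE x in P. f x = g x)"
proof
  assume "rv_class P f = rv_class P g"
  moreover have "f \<in> rv_class P f" using assms by (simp add: rv_class_def)
  ultimately show "AE x in P. f x = g x" by (auto simp: rv_class_def)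
next
  assume fg: "AE x in P. f x = g x"
  have "(AE x in P. h x = f x) \<longleftrightarrow> (AE x in P. h x = g x)" for h
  proof
    assume "AE x in P. h x = f x"
    with fg show "AE x in P. h x = g x" by eventually_elim simp
  next
    assume "AE x in P. h x = g x"
    with fg show "AE x in P. h x = f x" by eventually_elim simp
  qed
  then show "rv_class P f = rv_class P g" by (simp add: rv_class_def)
qed

lemma L2_operations:
  assumes f: "f \<in> borel_measurable P" and g: "g \<in> borel_measurable P"
  shows "vadd (L2 P G) (rv_class P f) (rv_class P g) = rv_class P (\<lambda>x. f x + g x)"
    and "vscale (L2 P G) c (rv_class P f) = rv_class P (\<lambda>x. c * f x)"
    and "vinner (L2 P G) (rv_class P f) (rv_class P g) = (\<integral>x. f x * g x \<partial>P)"
proof -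
  note [measurable] = f g rv_rep_class(1)[OF f] rv_rep_class(1)[OF g]
  note ae = rv_rep_class(2)[OF f] rv_rep_class(2)[OF g]
  have "rv_class P (\<lambda>x. rv_rep (rv_class P f) x + rv_rep (rv_class P g) x)
      = rv_class P (\<lambda>x. f x + g x)"
    by (subst rv_class_eq_iff) (measurable, use ae in \<open>eventually_elim, simp\<close>)
  then show "vadd (L2 P G) (rv_class P f) (rv_class P g) = rv_class P (\<lambda>x. f x + g x)"
    by (simp add: L2_def)
  have "rv_class P (\<lambda>x. c * rv_rep (rv_class P f) x) = rv_class P (\<lambda>x. c * f x)"
    by (subst rv_class_eq_iff) (measurable, use ae in \<open>eventually_elim, simp\<close>)
  then show "vscale (L2 P G) c (rv_class P f) = rv_class P (\<lambda>x. c * f x)"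
    by (simp add: L2_def)
  have "(\<integral>x. rv_rep (rv_class P f) x * rv_rep (rv_class P g) x \<partial>P) = (\<integral>x. f x * g x \<partial>P)"
    by (rule integral_cong_AE) (measurable, use ae in \<open>eventually_elim, simp\<close>)
  then show "vinner (L2 P G) (rv_class P f) (rv_class P g) = (\<integral>x. f x * g x \<partial>P)"
    by (simp add: L2_def)
qed

lemma J_rv_class:
  assumes f: "f \<in> borel_measurable P" and g: "g \<in> borel_measurable P"
  shows "J P (rv_class P f) (rv_class P g)
       = 1 / 2 * (\<integral>x. \<bar>g x\<bar>\<^sup>2 \<partial>P) - (\<integral>x. f x * g x \<partial>P)"
proof -
  note [measurable] = f g rv_rep_class(1)[OF f] rv_rep_class(1)[OF g]
  note ae = rv_rep_class(2)[OF f] rv_rep_class(2)[OF g]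
  have "(\<integral>x. rv_rep (rv_class P f) x * rv_rep (rv_class P g) x \<partial>P) = (\<integral>x. f x * g x \<partial>P)"
    by (rule integral_cong_AE) (measurable, use ae in \<open>eventually_elim, simp\<close>)
  moreover have "(\<integral>x. \<bar>rv_rep (rv_class P g) x\<bar>\<^sup>2 \<partial>P) = (\<integral>x. \<bar>g x\<bar>\<^sup>2 \<partial>P)"
    by (rule integral_cong_AE) (measurable, use ae in \<open>eventually_elim, simp\<close>)
  ultimately show ?thesis by (simp add: J_def)
qed

lemma vectors_L2:
  assumes sub: "subalgebra P G"
  shows "vectors (L2 P G) =
    rv_class P ` {f \<in> borel_measurable G. integrable P (\<lambda>x. (f x)\<^sup>2)}"
proof -
  have "f \<in> square_integrable (restr_to_subalg P G) \<longleftrightarrow>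
      f \<in> borel_measurable G \<and> integrable P (\<lambda>x. (f x)\<^sup>2)" for f :: "'a \<Rightarrow> real"
  proof -
    have m: "borel_measurable (restr_to_subalg P G) = (borel_measurable G :: ('a \<Rightarrow> real) set)"
      using sub by (intro measurable_cong_sets) (auto simp: sets_restr_to_subalg)
    have "integrable (restr_to_subalg P G) (\<lambda>x. (f x)\<^sup>2) \<longleftrightarrow> integrable P (\<lambda>x. (f x)\<^sup>2)"
      if "f \<in> borel_measurable G"
      using integrable_from_subalg[OF sub] integrable_in_subalg[OF sub, of "\<lambda>x. (f x)\<^sup>2"] that
      by auto
    then show ?thesis by (auto simp: square_integrable_def m)
  qed
  then have "square_integrable (restr_to_subalg P G) =
      {f \<in> borel_measurable G. integrable P (\<lambda>x. (f x)\<^sup>2)}" by auto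
  then show ?thesis by (simp add: L2_def)
qed

lemma L2_riesz_fischer:
  fixes s :: "nat \<Rightarrow> 'a \<Rightarrow> real"
  assumes "prob_space N"
    and [measurable]: "\<And>n. s n \<in> borel_measurable N"
    and sq: "\<And>n. integrable N (\<lambda>x. (s n x)\<^sup>2)"
    and cau: "\<And>e. e > 0 \<Longrightarrow> \<exists>K. \<forall>m\<ge>K. \<forall>n\<ge>K. (\<integral>x. (s m x - s n x)\<^sup>2 \<partial>N) < e"
  obtains g where "g \<in> borel_measurable N" "integrable N (\<lambda>x. (g x)\<^sup>2)"
    "(\<lambda>n. \<integral>x. (s n x - g x)\<^sup>2 \<partial>N) \<longlonglongrightarrow> 0"
proof -
  interpret prob_space N by fact
  have sqd: "integrable N (\<lambda>x. (a x - b x)\<^sup>2)"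
    if [measurable]: "a \<in> borel_measurable N" "b \<in> borel_measurable N"
      and i: "integrable N (\<lambda>x. (a x)\<^sup>2)" "integrable N (\<lambda>x. (b x)\<^sup>2)" for a b :: "'a \<Rightarrow> real"
  proof (rule Bochner_Integration.integrable_bound)
    show "integrable N (\<lambda>x. 2 * (a x)\<^sup>2 + 2 * (b x)\<^sup>2)" using i by simp
    have "(a x - b x)\<^sup>2 \<le> 2 * (a x)\<^sup>2 + 2 * (b x)\<^sup>2" for x
      using zero_le_power2[of "a x + b x"] by (simp add: power2_eq_square algebra_simps)
    then show "AE x in N. norm ((a x - b x)\<^sup>2) \<le> norm (2 * (a x)\<^sup>2 + 2 * (b x)\<^sup>2)"
      by (intro AE_I2) simp
  qed simp
  have int: "integrable N a" if "a \<in> borel_measurable N" "integrable N (\<lambda>x. (a x)\<^sup>2)"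
    for a :: "'a \<Rightarrow> real"
    using that by (rule square_integrable_imp_integrable)
  have L1: "(\<integral>x. \<bar>a x\<bar> \<partial>N)\<^sup>2 \<le> (\<integral>x. (a x)\<^sup>2 \<partial>N)"
    if m: "a \<in> borel_measurable N" and i: "integrable N (\<lambda>x. (a x)\<^sup>2)" for a :: "'a \<Rightarrow> real"
  proof -
    have "variance (\<lambda>x. \<bar>a x\<bar>) = (\<integral>x. \<bar>a x\<bar>\<^sup>2 \<partial>N) - (\<integral>x. \<bar>a x\<bar> \<partial>N)\<^sup>2"
      using int[OF m i] i by (intro variance_eq) auto
    then show ?thesis using variance_positive[of "\<lambda>x. \<bar>a x\<bar>"] by simp
  qed
  have "\<exists>K. \<forall>i\<ge>K. \<forall>j\<ge>K. (\<integral>x. norm (s i x - s j x) \<partial>N) < e" if e: "e > 0" for e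
  proof -
    obtain K where K: "(\<integral>x. (s i x - s j x)\<^sup>2 \<partial>N) < e\<^sup>2" if "i \<ge> K" "j \<ge> K" for i j
      using cau[of "e\<^sup>2"] e by auto
    have "(\<integral>x. norm (s i x - s j x) \<partial>N) < e" if "i \<ge> K" "j \<ge> K" for i j
    proof -
      have "(\<integral>x. \<bar>s i x - s j x\<bar> \<partial>N)\<^sup>2 < e\<^sup>2"
        using L1[of "\<lambda>x. s i x - s j x"] sqd[of "s i" "s j"] sq K[OF that] by fastforce
      then show ?thesis using e by (auto intro: power2_less_imp_less)
    qed
    then show ?thesis by blast
  qed
  then obtain r where r: "strict_mono r" "AE x in N. Cauchy (\<lambda>i. s (r i) x)"
    using cauchy_L1_AE_cauchy_subseq[of N s] int sq by (metis assms(2))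
  define g where "g = (\<lambda>x. lim (\<lambda>i. s (r i) x))"
  have g[measurable]: "g \<in> borel_measurable N" unfolding g_def by measurable
  have conv: "AE x in N. (\<lambda>i. s (r i) x) \<longlonglongrightarrow> g x"
    using r(2) by eventually_elim (simp add: g_def real_Cauchy_convergent convergent_LIMSEQ_iff[symmetric])
  have key: "\<exists>K. \<forall>n\<ge>K. (\<integral>\<^sup>+x. ennreal ((s n x - g x)\<^sup>2) \<partial>N) \<le> ennreal e" if e: "e > 0" for e
  proof -
    obtain K where K: "(\<integral>x. (s i x - s j x)\<^sup>2 \<partial>N) < e" if "i \<ge> K" "j \<ge> K" for i j
      using cau[OF e] by auto
    have "(\<integral>\<^sup>+x. ennreal ((s n x - g x)\<^sup>2) \<partial>N) \<le> ennreal e" if n: "n \<ge> K" for n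
    proof -
      have "(\<integral>\<^sup>+x. ennreal ((s n x - g x)\<^sup>2) \<partial>N)
          = (\<integral>\<^sup>+x. liminf (\<lambda>k. ennreal ((s n x - s (r k) x)\<^sup>2)) \<partial>N)"
      proof (rule nn_integral_cong_AE, use conv in eventually_elim)
        case (elim x)
        then have "(\<lambda>k. ennreal ((s n x - s (r k) x)\<^sup>2)) \<longlonglongrightarrow> ennreal ((s n x - g x)\<^sup>2)"
          by (intro tendsto_intros)
        then show ?case using lim_imp_Liminf[OF sequentially_bot] by metis
      qed
      also have "\<dots> \<le> liminf (\<lambda>k. \<integral>\<^sup>+x. ennreal ((s n x - s (r k) x)\<^sup>2) \<partial>N)"
        by (rule nn_integral_liminf) measurable
      also have "\<dots> \<le> ennreal e"
      proof (rule Liminf_le)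
        show "\<forall>\<^sub>F k in sequentially. (\<integral>\<^sup>+x. ennreal ((s n x - s (r k) x)\<^sup>2) \<partial>N) \<le> ennreal e"
        proof (rule eventually_sequentiallyI[of K])
          fix k assume "K \<le> k"
          then have "r k \<ge> K" using seq_suble[OF r(1), of k] by simp
          then have "(\<integral>x. (s n x - s (r k) x)\<^sup>2 \<partial>N) \<le> e" using K[OF n] by (simp add: less_imp_le)
          then show "(\<integral>\<^sup>+x. ennreal ((s n x - s (r k) x)\<^sup>2) \<partial>N) \<le> ennreal e"
            using sqd[of "s n" "s (r k)"] sq
            by (subst nn_integral_eq_integral) (auto intro: ennreal_leI)
        qed
      qed simp
      finally show ?thesis .
    qed
    then show ?thesis by blast
  qed
  obtain K1 where K1: "(\<integral>\<^sup>+x. ennreal ((s K1 x - g x)\<^sup>2) \<partial>N) \<le> ennreal 1"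
    using key[of 1] by auto
  then have i1: "integrable N (\<lambda>x. (s K1 x - g x)\<^sup>2)"
    by (intro integrableI_bounded) (auto simp: ennreal_le_1 intro: le_less_trans)
  have gsq: "integrable N (\<lambda>x. (g x)\<^sup>2)"
    using sqd[of "s K1" "\<lambda>x. s K1 x - g x"] i1 sq by simp
  have "(\<lambda>n. \<integral>x. (s n x - g x)\<^sup>2 \<partial>N) \<longlonglongrightarrow> 0"
  proof (rule LIMSEQ_I)
    fix e :: real assume "e > 0"
    then obtain K where K: "\<And>n. n \<ge> K \<Longrightarrow>
        (\<integral>\<^sup>+x. ennreal ((s n x - g x)\<^sup>2) \<partial>N) \<le> ennreal (e / 2)"
      using key[of "e / 2"] by auto
    have "norm ((\<integral>x. (s n x - g x)\<^sup>2 \<partial>N) - 0) < e" if "n \<ge> K" for n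
    proof -
      have "ennreal (\<integral>x. (s n x - g x)\<^sup>2 \<partial>N) \<le> ennreal (e / 2)"
        using K[OF that] sqd[of "s n" g] sq gsq by (subst (asm) nn_integral_eq_integral) auto
      then have "(\<integral>x. (s n x - g x)\<^sup>2 \<partial>N) \<le> e / 2" using \<open>e > 0\<close> by (simp add: ennreal_le_iff)
      then show ?thesis using \<open>e > 0\<close> by simp
    qed
    then show "\<exists>K. \<forall>n\<ge>K. norm ((\<integral>x. (s n x - g x)\<^sup>2 \<partial>N) - 0) < e" by blast
  qed
  with g gsq show ?thesis by (rule that)
qed

lemma real_hilbert_space_L2:
  assumes P: "prob_space P" and sub: "subalgebra P G"
  shows "real_hilbert_space (L2 P G)"
proof -
  interpret prob_space P by fact
  define S :: "('a \<Rightarrow> real) set"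
    where "S = {f \<in> borel_measurable G. integrable P (\<lambda>x. (f x)\<^sup>2)}"
  have S_iff: "f \<in> S \<longleftrightarrow> f \<in> borel_measurable G \<and> integrable P (\<lambda>x. (f x)\<^sup>2)" for f
    by (simp add: S_def)
  have mP: "f \<in> borel_measurable P" if "f \<in> S" for f
    using that measurable_from_subalg[OF sub] by (auto simp: S_iff)
  have V: "vectors (L2 P G) = rv_class P ` S" unfolding S_def by (rule vectors_L2[OF sub])
  have ex: "\<exists>f\<in>S. u = rv_class P f" if "u \<in> vectors (L2 P G)" for u
    using that V by auto
  have inI: "rv_class P f \<in> vectors (L2 P G)" if "f \<in> S" for f using that V by auto
  have zero: "vzero (L2 P G) = rv_class P (\<lambda>x. 0)" by (simp add: L2_def)
  have S0: "(\<lambda>x. 0) \<in> S" by (simp add: S_iff)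
  have Sadd: "(\<lambda>x. f x + g x) \<in> S" if "f \<in> S" "g \<in> S" for f g
  proof -
    have [measurable]: "f \<in> borel_measurable P" "g \<in> borel_measurable P" using that mP by auto
    have "integrable P (\<lambda>x. (f x + g x)\<^sup>2)"
    proof (rule Bochner_Integration.integrable_bound)
      show "integrable P (\<lambda>x. 2 * (f x)\<^sup>2 + 2 * (g x)\<^sup>2)" using that by (simp add: S_iff)
      have "(f x + g x)\<^sup>2 \<le> 2 * (f x)\<^sup>2 + 2 * (g x)\<^sup>2" for x
        using zero_le_power2[of "f x - g x"] by (simp add: power2_eq_square algebra_simps)
      then show "AE x in P. norm ((f x + g x)\<^sup>2) \<le> norm (2 * (f x)\<^sup>2 + 2 * (g x)\<^sup>2)"
        by (intro AE_I2) simp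
    qed simp
    then show ?thesis using that by (auto simp: S_iff)
  qed
  have Sscale: "(\<lambda>x. c * f x) \<in> S" if "f \<in> S" for f c
    using that by (auto simp: S_iff power_mult_distrib)
  have prodi: "integrable P (\<lambda>x. f x * g x)" if "f \<in> S" "g \<in> S" for f g
  proof (rule Bochner_Integration.integrable_bound)
    have [measurable]: "f \<in> borel_measurable P" "g \<in> borel_measurable P" using that mP by auto
    show "(\<lambda>x. f x * g x) \<in> borel_measurable P" by simp
    show "integrable P (\<lambda>x. (f x)\<^sup>2 + (g x)\<^sup>2)" using that by (simp add: S_iff)
    have "\<bar>f x * g x\<bar> \<le> (f x)\<^sup>2 + (g x)\<^sup>2" for x
    proof -
      have "2 * \<bar>f x * g x\<bar> \<le> (f x)\<^sup>2 + (g x)\<^sup>2"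
        using sum_squares_bound[of "\<bar>f x\<bar>" "\<bar>g x\<bar>"] by (simp add: abs_mult mult.assoc)
      then show ?thesis by linarith
    qed
    then show "AE x in P. norm (f x * g x) \<le> norm ((f x)\<^sup>2 + (g x)\<^sup>2)" by (intro AE_I2) simp
  qed
  note op = L2_operations[OF mP mP]
  have dist: "vdist (L2 P G) (rv_class P f) (rv_class P g) = sqrt (\<integral>x. (f x - g x)\<^sup>2 \<partial>P)"
    if "f \<in> S" "g \<in> S" for f g
  proof -
    have d: "(\<lambda>x. f x + -1 * g x) \<in> S" by (rule Sadd[OF that(1) Sscale[OF that(2)]])
    then have "vinner (L2 P G) (rv_class P (\<lambda>x. f x + -1 * g x)) (rv_class P (\<lambda>x. f x + -1 * g x))
        = (\<integral>x. (f x - g x)\<^sup>2 \<partial>P)"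
      unfolding op(3)[OF d d] by (simp add: power2_eq_square)
    moreover have "vadd (L2 P G) (rv_class P f) (vscale (L2 P G) (-1) (rv_class P g))
        = rv_class P (\<lambda>x. f x + -1 * g x)"
      unfolding op(2)[OF that(2) that(2)] by (rule op(1)[OF that(1) Sscale[OF that(2)]])
    ultimately show ?thesis unfolding vdist_def Let_def by (simp only:)
  qed
  show ?thesis
  proof
    show "vzero (L2 P G) \<in> vectors (L2 P G)" using inI[OF S0] zero by simp
  next
    fix u v assume "u \<in> vectors (L2 P G)" "v \<in> vectors (L2 P G)"
    then obtain f g where f: "f \<in> S" "u = rv_class P f" and g: "g \<in> S" "v = rv_class P g"
      using ex by metis
    show "vadd (L2 P G) u v \<in> vectors (L2 P G)"
      using op(1)[OF f(1) g(1)] inI[OF Sadd[OF f(1) g(1)]] f g by simp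
    show "vadd (L2 P G) u v = vadd (L2 P G) v u"
      using op(1)[OF f(1) g(1)] op(1)[OF g(1) f(1)] f g by (simp add: add.commute)
    show "vinner (L2 P G) u v = vinner (L2 P G) v u"
      using op(3)[OF f(1) g(1)] op(3)[OF g(1) f(1)] f g by (simp add: mult.commute)
    fix c
    show "vscale (L2 P G) c (vadd (L2 P G) u v) = vadd (L2 P G) (vscale (L2 P G) c u) (vscale (L2 P G) c v)"
      unfolding f(2) g(2) op(1)[OF f(1) g(1)] op(2)[OF f(1) f(1)] op(2)[OF g(1) g(1)]
        op(1)[OF Sscale[OF f(1)] Sscale[OF g(1)]] op(2)[OF Sadd[OF f(1) g(1)] f(1)]
      by (simp add: algebra_simps)
    show "vinner (L2 P G) (vscale (L2 P G) c u) v = c * vinner (L2 P G) u v"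
      unfolding f(2) g(2) op(2)[OF f(1) f(1)] op(3)[OF f(1) g(1)] op(3)[OF Sscale[OF f(1)] g(1)]
      by (simp add: mult.assoc)
  next
    fix u v w assume "u \<in> vectors (L2 P G)" "v \<in> vectors (L2 P G)" "w \<in> vectors (L2 P G)"
    then obtain f g h where f: "f \<in> S" "u = rv_class P f" and g: "g \<in> S" "v = rv_class P g"
      and h: "h \<in> S" "w = rv_class P h"
      using ex by metis
    show "vadd (L2 P G) (vadd (L2 P G) u v) w = vadd (L2 P G) u (vadd (L2 P G) v w)"
      unfolding f(2) g(2) h(2) op(1)[OF f(1) g(1)] op(1)[OF g(1) h(1)]
        op(1)[OF Sadd[OF f(1) g(1)] h(1)] op(1)[OF f(1) Sadd[OF g(1) h(1)]]
      by (simp add: add.assoc)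
    show "vinner (L2 P G) (vadd (L2 P G) u v) w = vinner (L2 P G) u w + vinner (L2 P G) v w"
      unfolding f(2) g(2) h(2) op(1)[OF f(1) g(1)] op(3)[OF Sadd[OF f(1) g(1)] h(1)]
        op(3)[OF f(1) h(1)] op(3)[OF g(1) h(1)]
      using prodi[OF f(1) h(1)] prodi[OF g(1) h(1)] by (simp add: distrib_right)
  next
    fix u assume "u \<in> vectors (L2 P G)"
    then obtain f where f: "f \<in> S" "u = rv_class P f" using ex by metis
    note sc = op(2)[OF f(1) f(1)]
    show "vscale (L2 P G) c u \<in> vectors (L2 P G)" for c
      using inI[OF Sscale[OF f(1)]] f sc by simp
    show "vadd (L2 P G) u (vzero (L2 P G)) = u"
      unfolding f(2) zero op(1)[OF f(1) S0] by simp
    show "vadd (L2 P G) u (vscale (L2 P G) (-1) u) = vzero (L2 P G)"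
      unfolding f(2) zero sc op(1)[OF f(1) Sscale[OF f(1)]] by simp
    show "vscale (L2 P G) 1 u = u" unfolding f(2) sc by simp
    show "vscale (L2 P G) b (vscale (L2 P G) c u) = vscale (L2 P G) (b * c) u" for b c
      unfolding f(2) sc op(2)[OF Sscale[OF f(1)] f(1)] by (simp add: mult.assoc)
    show "vscale (L2 P G) (b + c) u = vadd (L2 P G) (vscale (L2 P G) b u) (vscale (L2 P G) c u)"
      for b c
      unfolding f(2) sc op(1)[OF Sscale[OF f(1)] Sscale[OF f(1)]] by (simp add: distrib_right)
    show "0 \<le> vinner (L2 P G) u u"
      unfolding f(2) op(3)[OF f(1) f(1)] by simp
    assume "vinner (L2 P G) u u = 0"
    then have "(\<integral>x. (f x)\<^sup>2 \<partial>P) = 0"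
      unfolding f(2) op(3)[OF f(1) f(1)] by (simp add: power2_eq_square)
    then have "AE x in P. (f x)\<^sup>2 = 0"
      using f(1) integral_nonneg_eq_0_iff_AE[of P "\<lambda>x. (f x)\<^sup>2"] by (simp add: S_iff)
    then show "u = vzero (L2 P G)"
      unfolding f(2) zero using mP[OF f(1)] by (subst rv_class_eq_iff) auto
  next
    fix U :: "nat \<Rightarrow> ('a \<Rightarrow> real) set"
    assume U: "\<And>n. U n \<in> vectors (L2 P G)"
      and cau: "\<And>e. e > 0 \<Longrightarrow> \<exists>N. \<forall>m\<ge>N. \<forall>n\<ge>N. vdist (L2 P G) (U m) (U n) < e"
    have "\<forall>n. \<exists>f. f \<in> S \<and> U n = rv_class P f" using ex U by blast
    then obtain s where s: "\<And>n. s n \<in> S" and Us: "\<And>n. U n = rv_class P (s n)" by metis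
    let ?N = "restr_to_subalg P G"
    have N: "prob_space ?N" by (rule prob_space_restr_to_subalg[OF sub P])
    have sm: "s n \<in> borel_measurable ?N" for n
      using s[of n] measurable_in_subalg[OF sub] by (auto simp: S_iff)
    have tr: "(\<integral>x. (a x - b x)\<^sup>2 \<partial>?N) = (\<integral>x. (a x - b x)\<^sup>2 \<partial>P)"
      if "a \<in> borel_measurable G" "b \<in> borel_measurable G" for a b :: "'a \<Rightarrow> real"
      using that by (intro integral_subalgebra2[OF sub]) simp
    have si: "integrable ?N (\<lambda>x. (s n x)\<^sup>2)" for n
      using s[of n] by (intro integrable_in_subalg[OF sub]) (auto simp: S_iff)
    have cauN: "\<exists>K. \<forall>m\<ge>K. \<forall>n\<ge>K. (\<integral>x. (s m x - s n x)\<^sup>2 \<partial>?N) < e" if "e > 0" for e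
    proof -
      have "(\<integral>x. (s m x - s n x)\<^sup>2 \<partial>?N) < e \<longleftrightarrow> vdist (L2 P G) (U m) (U n) < sqrt e" for m n
        using dist[OF s s, of m n] tr[of "s m" "s n"] s[of m] s[of n] by (simp add: Us S_iff)
      then show ?thesis using cau[of "sqrt e"] that by simp
    qed
    obtain g where g: "g \<in> borel_measurable ?N" "integrable ?N (\<lambda>x. (g x)\<^sup>2)"
      and lim: "(\<lambda>n. \<integral>x. (s n x - g x)\<^sup>2 \<partial>?N) \<longlonglongrightarrow> 0"
      by (rule L2_riesz_fischer[OF N sm si cauN])
    have gm: "g \<in> borel_measurable G" by (rule measurable_in_subalg'[OF sub g(1)])
    have gS: "g \<in> S" using gm integrable_from_subalg[OF sub g(2)] by (simp add: S_iff)
    have "vdist (L2 P G) (U n) (rv_class P g) = sqrt (\<integral>x. (s n x - g x)\<^sup>2 \<partial>?N)" for n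
      using dist[OF s gS, of n] tr[of "s n" g] s[of n] gm by (simp add: Us S_iff)
    then have "(\<lambda>n. vdist (L2 P G) (U n) (rv_class P g)) \<longlonglongrightarrow> 0"
      using tendsto_real_sqrt[OF lim] by simp
    then show "\<exists>u\<in>vectors (L2 P G). (\<lambda>n. vdist (L2 P G) (U n) u) \<longlonglongrightarrow> 0"
      using inI[OF gS] by blast
  qed
qed

end

theory Submission
  imports Defs
begin

text \<open>
  Let \<open>Z\<close> be the conditional expectation of \<open>X\<close> given \<open>G\<close>. It is square-integrable by Jensen's
  inequality, and \<open>X\<close> and \<open>Z\<close> have the same inner product with every vector of \<open>L\<^sup>2(G)\<close>, so on that
  space \<open>J Y = \<langle>Y,Y\<rangle>/2 - \<langle>Z,Y\<rangle>\<close>. The derivative of such a functional at \<open>Y\<close> is \<open>V \<mapsto> \<langle>Y - Z,V\<rangle>\<close>,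
  which vanishes identically exactly for \<open>Y = Z\<close>.
\<close>

context real_hilbert_space
begin

lemma inner_add_right:
  assumes "u \<in> vectors H" "v \<in> vectors H" "w \<in> vectors H"
  shows "vinner H w (vadd H u v) = vinner H w u + vinner H w v"
  using assms by (metis add_closed inner_add inner_commute)

lemma inner_scale_right:
  assumes "u \<in> vectors H" "v \<in> vectors H"
  shows "vinner H v (vscale H c u) = c * vinner H v u"
  using assms by (metis inner_commute inner_scale scale_closed)

text \<open>Bilinearity and symmetry merge the two cross terms, so for \<open>t \<noteq> 0\<close>
  the quotient is affine in \<open>t\<close> with slope \<open>vinner H v v / 2\<close>; the
  constant term is the limit.\<close>

lemma diff_quotient_quadratic:
  assumes F: "\<And>u. u \<in> vectors H \<Longrightarrow> F u = 1 / 2 * vinner H u u - vinner H z u"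
    and z: "z \<in> vectors H" and u: "u \<in> vectors H" and v: "v \<in> vectors H"
  shows "(diff_quotient F u v \<longlongrightarrow> vinner H u v - vinner H z v) (at 0)"
proof -
  have eq: "diff_quotient F u v t = vinner H u v - vinner H z v + t / 2 * vinner H v v"
    if "t \<noteq> 0" for t
  proof -
    have tv: "vscale H t v \<in> vectors H" using v by (rule scale_closed)
    have "F (vadd H u (vscale H t v)) - F u
        = t * (vinner H u v - vinner H z v + t / 2 * vinner H v v)"
      using u v z tv
      by (simp add: F add_closed inner_add inner_add_right inner_scale inner_scale_right
          inner_commute[of v u] algebra_simps)
    then show ?thesis using that by (simp add: diff_quotient_def)
  qed
  have "((\<lambda>t. vinner H u v - vinner H z v + t / 2 * vinner H v v)
      \<longlongrightarrow> vinner H u v - vinner H z v + 0 / 2 * vinner H v v) (at 0)"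
    by (intro tendsto_intros) simp
  then have "((\<lambda>t. vinner H u v - vinner H z v + t / 2 * vinner H v v)
      \<longlongrightarrow> vinner H u v - vinner H z v) (at 0)" by simp
  \<comment> \<open>At \<open>t = 0\<close> the quotient is \<open>0\<close> by the convention for
    division, so the two functions are compared only away from \<open>0\<close>.\<close>
  then show ?thesis
    by (rule Lim_transform_eventually) (auto simp: eventually_at_filter eq)
qed

lemma gateaux_deriv_quadratic:
  assumes "\<And>u. u \<in> vectors H \<Longrightarrow> F u = 1 / 2 * vinner H u u - vinner H z u"
    and "z \<in> vectors H" "u \<in> vectors H" "v \<in> vectors H"
  shows "gateaux_deriv F u v = vinner H u v - vinner H z v"
  unfolding gateaux_deriv_def
  using assms by (intro tendsto_Lim diff_quotient_quadratic) auto

text \<open>The difference of \<open>u\<close> and \<open>z\<close> is orthogonal to every vector,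
  in particular to itself, so definiteness makes it zero.\<close>

lemma eq_if_inner_eq:
  assumes u: "u \<in> vectors H" and z: "z \<in> vectors H"
    and eq: "\<And>v. v \<in> vectors H \<Longrightarrow> vinner H u v = vinner H z v"
  shows "u = z"
proof -
  let ?n = "vscale H (-1) z"
  have n: "?n \<in> vectors H" using z by (rule scale_closed)
  have d: "vadd H u ?n \<in> vectors H" using u n by (rule add_closed)
  have "vinner H (vadd H u ?n) (vadd H u ?n) = 0"
    using u z n d by (simp add: inner_add inner_scale eq)
  then have "vadd H u ?n = vzero H" using d by (simp add: inner_eq_zero)
  \<comment> \<open>With an explicit carrier there is no subtraction to cancel: \<open>z\<close> is
    added back and the sum reassociated.\<close>
  then have "vadd H (vadd H u ?n) z = z" using z zero_closed by (simp add: add_commute add_zero)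
  moreover have "vadd H ?n z = vzero H" using z n by (simp add: add_commute add_neg)
  ultimately show ?thesis using u z n by (simp add: add_assoc add_zero)
qed

lemma critical_point_quadratic_iff:
  assumes F: "\<And>u. u \<in> vectors H \<Longrightarrow> F u = 1 / 2 * vinner H u u - vinner H z u"
    and z: "z \<in> vectors H"
  shows "critical_point F u \<longleftrightarrow> u = z"
proof
  assume crit: "critical_point F u"
  then have u: "u \<in> vectors H" by (simp add: critical_point_def gateaux_differentiable_def)
  show "u = z"
  proof (rule eq_if_inner_eq[OF u z])
    fix v assume v: "v \<in> vectors H"
    then have "gateaux_deriv F u v = 0" using crit by (simp add: critical_point_def)
    then show "vinner H u v = vinner H z v"
      using gateaux_deriv_quadratic[OF F z u v] by simp
  qed
next
  assume "u = z"
  have zero: "gateaux_deriv F z v = 0" if "v \<in> vectors H" for v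
    using gateaux_deriv_quadratic[OF F z z that] by simp
  \<comment> \<open>Differentiability is needed only at \<open>z\<close>, where the derivative is
    the zero functional on the carrier; hence linearity is immediate and any radius witnesses
    continuity.\<close>
  have "linear_functional (gateaux_deriv F z)"
    by (simp add: linear_functional_def zero add_closed scale_closed)
  moreover have "continuous_functional (gateaux_deriv F z)"
    by (auto simp: continuous_functional_def zero intro: exI[of _ 1])
  ultimately show "critical_point F u"
    using z zero diff_quotient_quadratic[OF F z z] \<open>u = z\<close>
    by (auto simp: critical_point_def gateaux_differentiable_def)
qed

end

text \<open>The product is dominated by the sum of the squares.\<close>

lemma integrable_mult_of_square_integrable:
  fixes f g :: "'a \<Rightarrow> real"
  assumes [measurable]: "f \<in> borel_measurable M" "g \<in> borel_measurable M"
    and "integrable M (\<lambda>x. (f x)\<^sup>2)" "integrable M (\<lambda>x. (g x)\<^sup>2)"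
  shows "integrable M (\<lambda>x. f x * g x)"
proof (rule Bochner_Integration.integrable_bound)
  show "integrable M (\<lambda>x. (f x)\<^sup>2 + (g x)\<^sup>2)" using assms by simp
  have "\<bar>a * b\<bar> \<le> a\<^sup>2 + b\<^sup>2" for a b :: real
  proof -
    have "2 * \<bar>a * b\<bar> \<le> a\<^sup>2 + b\<^sup>2"
      using sum_squares_bound[of "\<bar>a\<bar>" "\<bar>b\<bar>"] by (simp add: abs_mult mult.assoc)
    then show ?thesis by linarith
  qed
  then show "AE x in M. norm (f x * g x) \<le> norm ((f x)\<^sup>2 + (g x)\<^sup>2)" by (intro AE_I2) simp
qed measurable

lemma (in prob_space) square_integrable_real_cond_exp:
  assumes sub: "subalgebra M G"
    and f: "f \<in> borel_measurable M" "integrable M (\<lambda>x. (f x)\<^sup>2)"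
  shows "integrable M (\<lambda>x. (real_cond_exp M G f x)\<^sup>2)"
proof -
  interpret finite_measure_subalgebra M G by standard (rule sub)
  have "convex_on UNIV (\<lambda>x :: real. x\<^sup>2)"
    using convex_power_even[of 2] by simp
  then show ?thesis
    \<comment> \<open>Jensen also requires \<open>f\<close> itself to be integrable, which follows
      because the measure is finite.\<close>
    using square_integrable_imp_integrable[OF f] f
    by (intro integrable_convex_cond_exp[where I = UNIV and X = f and q = "\<lambda>x. x\<^sup>2"]) auto
qed

theorem theorem2p5:
  fixes P G :: "'a measure" and X :: "('a \<Rightarrow> real) set"
  assumes "prob_space P"
    and "subalgebra P G"
    and "X \<in> vectors (L2 P P)"
  shows "\<exists>!Y. Y \<in> vectors (L2 P G) \<and> real_hilbert_space.critical_point (L2 P G) (J P X) Y"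
proof -
  interpret prob_space P by fact
  interpret finite_measure_subalgebra P G by standard fact
  interpret L2: real_hilbert_space "L2 P G" using assms(1,2) by (rule real_hilbert_space_L2)
  have "subalgebra P P" by (simp add: subalgebra_def)
  then obtain f where f[measurable]: "f \<in> borel_measurable P"
    and f2: "integrable P (\<lambda>x. (f x)\<^sup>2)" and X: "X = rv_class P f"
    using assms(3) by (auto simp: vectors_L2)
  let ?h = "real_cond_exp P G f"
  have h2: "integrable P (\<lambda>x. (?h x)\<^sup>2)"
    using assms(2) f f2 by (rule square_integrable_real_cond_exp)
  \<comment> \<open>The conditional expectation \<open>?h\<close> is a \<open>G\<close>-measurable
    function, so it serves as the representative required by the smaller space.\<close>
  have Z: "rv_class P ?h \<in> vectors (L2 P G)" using h2 by (simp add: vectors_L2[OF assms(2)])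
  have "J P X Y = 1 / 2 * vinner (L2 P G) Y Y - vinner (L2 P G) (rv_class P ?h) Y"
    if "Y \<in> vectors (L2 P G)" for Y
  proof -
    obtain g where g: "g \<in> borel_measurable G" "integrable P (\<lambda>x. (g x)\<^sup>2)"
      and Y: "Y = rv_class P g"
      using \<open>Y \<in> vectors (L2 P G)\<close> by (auto simp: vectors_L2[OF assms(2)])
    have gP[measurable]: "g \<in> borel_measurable P"
      using assms(2) g(1) by (rule measurable_from_subalg)
    \<comment> \<open>Defining property of conditional expectation, tested against the
      \<open>G\<close>-measurable \<open>g\<close>; it requires \<open>g * f\<close> to be
      integrable.\<close>
    have "(\<integral>x. g x * ?h x \<partial>P) = (\<integral>x. g x * f x \<partial>P)"
      using integrable_mult_of_square_integrable[OF gP f g(2) f2] g(1) f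
      by (rule real_cond_exp_intg(2))
    then have "(\<integral>x. ?h x * g x \<partial>P) = (\<integral>x. f x * g x \<partial>P)" by (simp add: mult.commute)
    then show ?thesis
      by (simp add: X Y J_rv_class L2_operations power2_eq_square)
  qed
  then have "L2.critical_point (J P X) Y \<longleftrightarrow> Y = rv_class P ?h" for Y
    using Z by (rule L2.critical_point_quadratic_iff)
  then show ?thesis using Z by auto
qed

end
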